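(* Let $E$ be an ellipse in the $(x,z)$-plane, and let $E(t)$, $t\in\mathbb{R}$, be the family of ellipses evolving from $E(0)=E$ under the flow $z_t=-z$, i.e. $E(t)$ is the image of $E$ under the orthogonal affinity $(x,z)\mapsto(x,e^{-t}z)$. Let $y(t)\in(0,1]$ denote the axis ratio of $E(t)$. (i) If the $z$ direction does not coincide with any of the principal directions of $E$, then $y(t)$ is a smooth quasiconcave function, and it reaches its global maximum at a point $t$ where the angle of the axes of the ellipse $E(t)$ with the axis of the affinity (the $x$-axis) is $\frac{\pi}{4}$. (ii) If the $z$ direction coincides with one of the principal directions of $E$, then $y(t)$ has a single maximum, at which it is not smooth, and it is smooth otherwise.
   Context: The axis ratio of an ellipse is the ratio of the length of its shorter axis to that of its longer axis. Principal directions are the directions of the axes of the ellipse (every direction in the case of a circle). A function on an interval is called quasiconcave here if it has one single (local) maximum and no (local) minima. *)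

theory Defs
  imports "HOL-Analysis.Analysis"
begin

text \<open>Points of the \<open>(x,z)\<close>-plane are pairs of type \<^typ>\<open>real \<times> real\<close>; the second component
  is the \<open>z\<close>-coordinate.\<close>

text \<open>\<open>ellipse_axes E c u v a b\<close>: the ellipse (curve) \<open>E\<close> has centre \<open>c\<close>, its longer axis has
  length \<open>2 * a\<close> and direction \<open>u\<close>, its shorter axis has length \<open>2 * b\<close> and direction \<open>v\<close>.
  For a circle the orthonormal frame \<open>u, v\<close> is arbitrary.\<close>

definition ellipse_axes ::
  "(real \<times> real) set \<Rightarrow> real \<times> real \<Rightarrow> real \<times> real \<Rightarrow> real \<times> real \<Rightarrow> real \<Rightarrow> real \<Rightarrow> bool" where
  "ellipse_axes E c u v a b \<longleftrightarrow>
     norm u = 1 \<and> norm v = 1 \<and> u \<bullet> v = 0 \<and> 0 < b \<and> b \<le> a \<and>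
     E = {p. (((p - c) \<bullet> u) / a)\<^sup>2 + (((p - c) \<bullet> v) / b)\<^sup>2 = 1}"

definition is_ellipse :: "(real \<times> real) set \<Rightarrow> bool" where
  "is_ellipse E \<longleftrightarrow> (\<exists>c u v a b. ellipse_axes E c u v a b)"

definition axis_ratio :: "(real \<times> real) set \<Rightarrow> real" where
  "axis_ratio E = (THE r. \<exists>c u v a b. ellipse_axes E c u v a b \<and> r = (2 * b) / (2 * a))"

definition principal_direction :: "(real \<times> real) set \<Rightarrow> real \<times> real \<Rightarrow> bool" where
  "principal_direction E d \<longleftrightarrow> d \<noteq> 0 \<and>
     (\<exists>c u v a b. ellipse_axes E c u v a b \<and> (\<exists>k. d = k *\<^sub>R u \<or> d = k *\<^sub>R v))"

text \<open>The time-\<open>t\<close> map of the flow \<open>z\<^sub>t = -z\<close>.\<close>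

definition affinity :: "real \<Rightarrow> real \<times> real \<Rightarrow> real \<times> real" where
  "affinity t = (\<lambda>(x, z). (x, exp (- t) * z))"

definition evolved :: "(real \<times> real) set \<Rightarrow> real \<Rightarrow> (real \<times> real) set" where
  "evolved E t = affinity t ` E"

text \<open>Angle in \<open>[0, \<pi>/2]\<close> between the unoriented lines spanned by two nonzero vectors.\<close>

definition line_angle :: "'a::real_inner \<Rightarrow> 'a \<Rightarrow> real" where
  "line_angle d e = arccos (\<bar>d \<bullet> e\<bar> / (norm d * norm e))"

text \<open>\<open>C\<^sup>\<infinity>\<close> in a neighbourhood of a point.\<close>

definition smooth_at :: "(real \<Rightarrow> real) \<Rightarrow> real \<Rightarrow> bool" where
  "smooth_at f x \<longleftrightarrow>
     (\<exists>U. open U \<and> x \<in> U \<and> (\<forall>n. \<forall>u\<in>U. (deriv ^^ n) f differentiable (at u)))"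

text \<open>Local extrema are meant in the non-strict sense, relative to the domain \<open>I\<close>.\<close>

definition local_max_on :: "real set \<Rightarrow> (real \<Rightarrow> real) \<Rightarrow> real \<Rightarrow> bool" where
  "local_max_on I f t \<longleftrightarrow> t \<in> I \<and> (\<forall>\<^sub>F s in at t within I. f s \<le> f t)"

definition local_min_on :: "real set \<Rightarrow> (real \<Rightarrow> real) \<Rightarrow> real \<Rightarrow> bool" where
  "local_min_on I f t \<longleftrightarrow> t \<in> I \<and> (\<forall>\<^sub>F s in at t within I. f t \<le> f s)"

text \<open>This is not the usual convexity-of-superlevel-sets notion: exactly one local maximum and
  no local minima.\<close>

definition quasiconcave_on :: "real set \<Rightarrow> (real \<Rightarrow> real) \<Rightarrow> bool" where
  "quasiconcave_on I f \<longleftrightarrow>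
     is_interval I \<and> (\<exists>!t. local_max_on I f t) \<and> \<not> (\<exists>t. local_min_on I f t)"

end

theory Submission
  imports Defs
begin

text \<open>
  An ellipse centred at \<open>c\<close> is the set where a positive definite quadratic form
  \<open>A x\<^sup>2 + 2 B x z + C z\<^sup>2\<close>, evaluated at \<open>p - c\<close>, equals 1, and the set determines both the
  centre and the form (\<open>conic_form_unique\<close>). Hence everything about the axes can be read off the
  form. The eigenvalues of its matrix are the inverse squares of the half axes, so the axis ratio
  \<open>r\<close> satisfies \<open>r + 1 / r = (A + C) / sqrt (A C - B\<^sup>2)\<close>, trace over root of the determinant
  (\<open>axis_ratio_conic_form\<close>); the principal directions are the eigenvectors, and
  in particular the \<open>z\<close> direction is principal exactly if \<open>B = 0\<close>.

  The affinity at time \<open>t\<close> changes the coefficients to \<open>A\<close>, \<open>B e\<^sup>t\<close>, \<open>C e\<^sup>2\<^sup>t\<close>. Therefore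
  \<open>y + 1 / y = 2 k cosh (t - t\<^sub>0)\<close> with \<open>k = sqrt (A C / (A C - B\<^sup>2))\<close> and
  \<open>t\<^sub>0 = ln (A / C) / 2\<close> (\<open>trace_over_root_det_evolved\<close>). As \<open>r + 1 / r\<close> decreases on \<open>(0, 1]\<close>,
  the ratio \<open>y\<close> strictly decreases with the distance from \<open>t\<^sub>0\<close>, which settles all questions about
  extrema. At \<open>t\<^sub>0\<close> the two diagonal coefficients agree, and if moreover \<open>B \<noteq> 0\<close>, the eigenvectors
  of such a matrix are the diagonals of the coordinate quadrants: this is the angle \<open>\<pi> / 4\<close>.

  Smoothness depends on whether the square root in
  \<open>y = w - sqrt (w\<^sup>2 - 1)\<close>, \<open>w = k cosh (t - t\<^sub>0)\<close>, meets its branch point. If \<open>B \<noteq> 0\<close>, then \<open>k > 1\<close>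
  and the radicand stays positive. If \<open>B = 0\<close>, then \<open>k = 1\<close> and \<open>y = exp (- \<bar>t - t\<^sub>0\<bar>)\<close>, which has a
  corner at \<open>t\<^sub>0\<close> and nowhere else.
\<close>

section \<open>Ellipses as level sets of quadratic forms\<close>

definition quad :: "real \<Rightarrow> real \<Rightarrow> real \<Rightarrow> real \<times> real \<Rightarrow> real" where
  "quad A B C p = A * (fst p)\<^sup>2 + 2 * B * fst p * snd p + C * (snd p)\<^sup>2"

definition conic_form ::
  "(real \<times> real) set \<Rightarrow> real \<times> real \<Rightarrow> real \<Rightarrow> real \<Rightarrow> real \<Rightarrow> bool" where
  "conic_form E c A B C \<longleftrightarrow>
     0 < A \<and> 0 < C \<and> B\<^sup>2 < A * C \<and> E = {p. quad A B C (p - c) = 1}"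

text \<open>
  Completing the square: \<open>A\<close> times the form is a sum of two nonnegative terms.
\<close>

lemma quad_pos:
  assumes "0 < A" "B\<^sup>2 < A * C" "p \<noteq> 0"
  shows "0 < quad A B C p"
proof -
  obtain x z where p: "p = (x, z)" by (cases p)
  have eq: "A * quad A B C p = (A * x + B * z)\<^sup>2 + (A * C - B\<^sup>2) * z\<^sup>2"
    by (simp add: quad_def p power2_eq_square algebra_simps)
  have "0 < (A * x + B * z)\<^sup>2 + (A * C - B\<^sup>2) * z\<^sup>2"
  proof (cases "z = 0")
    case True
    then show ?thesis using assms p by (simp add: zero_prod_def)
  next
    case False
    then have "0 < (A * C - B\<^sup>2) * z\<^sup>2" using assms by simp
    then show ?thesis by (simp add: add_nonneg_pos)
  qed
  then show ?thesis using eq assms(1) by (metis zero_less_mult_pos)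
qed

lemma quad_scaleR: "quad A B C (k *\<^sub>R p) = k\<^sup>2 * quad A B C p"
  by (simp add: quad_def power2_eq_square algebra_simps)

text \<open>
  Every line through the centre \<open>c\<close> of the first form meets \<open>E\<close> in two points
  \<open>c \<plusminus> k w\<close>. Applied to the line through both centres, the second form takes the
  same value at \<open>(1 + k) (c - c')\<close> and \<open>(1 - k) (c - c')\<close>, which forces \<open>c = c'\<close>. With a common
  centre, both forms are 1 at \<open>k w\<close>, so by homogeneity they agree in every direction.
\<close>

lemma conic_form_unique:
  assumes 1: "conic_form E c A B C" and 2: "conic_form E c' A' B' C'"
  shows "c = c'" "A = A'" "B = B'" "C = C'"
proof -
  have on: "quad A' B' C' (c + k *\<^sub>R w - c') = 1" if "w \<noteq> 0" "k\<^sup>2 * quad A B C w = 1" for w k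
  proof -
    have "c + k *\<^sub>R w \<in> E" using 1 that by (simp add: conic_form_def quad_scaleR)
    then show ?thesis using 2 by (simp add: conic_form_def)
  qed
  have root: "(1 / sqrt (quad A B C w))\<^sup>2 * quad A B C w = 1" if "w \<noteq> 0" for w
    using quad_pos[of A B C w] 1 that by (simp add: conic_form_def power_divide)
  show c: "c = c'"
  proof (rule ccontr)
    assume "c \<noteq> c'"
    define w where "w = c - c'"
    define k where "k = 1 / sqrt (quad A B C w)"
    have w: "w \<noteq> 0" using \<open>c \<noteq> c'\<close> by (simp add: w_def)
    have k: "k\<^sup>2 * quad A B C w = 1" using root[OF w] by (simp add: k_def)
    have "quad A' B' C' (w + k *\<^sub>R w) = 1" "quad A' B' C' (w - k *\<^sub>R w) = 1"
      using on[OF w k] on[of w "- k"] w k by (simp_all add: w_def algebra_simps)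
    then have "quad A' B' C' ((1 + k) *\<^sub>R w) = quad A' B' C' ((1 - k) *\<^sub>R w)"
      by (simp add: algebra_simps)
    then have "((1 + k)\<^sup>2 - (1 - k)\<^sup>2) * quad A' B' C' w = 0"
      by (simp only: quad_scaleR left_diff_distrib)
    moreover have "quad A' B' C' w > 0" using quad_pos 2 w by (simp add: conic_form_def)
    moreover have "(1 + k)\<^sup>2 - (1 - k)\<^sup>2 = 4 * k" by (simp add: power2_eq_square algebra_simps)
    moreover have "k \<noteq> 0" using k by auto
    ultimately show False by simp
  qed
  have eq: "quad A' B' C' w = quad A B C w" if "w \<noteq> 0" for w
    using on[OF that root[OF that]] root[OF that] c
    by (simp add: quad_scaleR) (metis mult_left_cancel mult_zero_left zero_neq_one)
  show A: "A = A'" using eq[of "(1, 0)"] by (simp add: quad_def zero_prod_def)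
  show C: "C = C'" using eq[of "(0, 1)"] by (simp add: quad_def zero_prod_def)
  show "B = B'" using eq[of "(1, 1)"] A C by (simp add: quad_def zero_prod_def)
qed

text \<open>
  In the plane, the second vector of an orthonormal frame is the first one turned by a right angle
  in one of the two senses, given by the sign \<open>s\<close>, the determinant of the frame.
\<close>

lemma orthonormal_frame_cases:
  assumes "norm u = 1" "norm v = 1" "u \<bullet> v = (0::real)"
  obtains s where "s\<^sup>2 = 1" "v = s *\<^sub>R (- snd u, fst u :: real)" "(fst u)\<^sup>2 + (snd u)\<^sup>2 = 1"
proof
  define s where "s = fst u * snd v - snd u * fst v"
  have u: "(fst u)\<^sup>2 + (snd u)\<^sup>2 = 1" and v: "(fst v)\<^sup>2 + (snd v)\<^sup>2 = 1"
    using assms(1,2) by (simp_all add: norm_prod_def)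
  have o: "fst u * fst v + snd u * snd v = 0" using assms(3) by (simp add: inner_prod_def)
  show "(fst u)\<^sup>2 + (snd u)\<^sup>2 = 1" by (rule u)
  have "s\<^sup>2 = ((fst u)\<^sup>2 + (snd u)\<^sup>2) * ((fst v)\<^sup>2 + (snd v)\<^sup>2) - (fst u * fst v + snd u * snd v)\<^sup>2"
    by (simp add: s_def power2_eq_square algebra_simps)
  then show "s\<^sup>2 = 1" using u v o by simp
  have "fst v = fst v * ((fst u)\<^sup>2 + (snd u)\<^sup>2)" using u by simp
  also have "\<dots> = - s * snd u + fst u * (fst u * fst v + snd u * snd v)"
    by (simp add: s_def power2_eq_square algebra_simps)
  finally have f: "fst v = - s * snd u" using o by simp
  have "snd v = snd v * ((fst u)\<^sup>2 + (snd u)\<^sup>2)" using u by simp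
  also have "\<dots> = s * fst u + snd u * (fst u * fst v + snd u * snd v)"
    by (simp add: s_def power2_eq_square algebra_simps)
  finally have "snd v = s * fst u" using o by simp
  with f show "v = s *\<^sub>R (- snd u, fst u)" by (simp add: prod_eq_iff)
qed

text \<open>
  The dictionary between frames and coefficients, which serves in both directions: to read off the
  form from given axes, and to find axes for a given form. Its coefficients are those of
  \<open>u u\<^sup>T / a\<^sup>2 + v v\<^sup>T / b\<^sup>2\<close>, where \<open>u = (x, z)\<close> and \<open>v\<close> are the axis directions.
\<close>

lemma ellipse_axes_iff_conic_form:
  assumes s: "s\<^sup>2 = 1" and n: "x\<^sup>2 + z\<^sup>2 = (1::real)" and ab: "0 < b" "b \<le> a"
    and A: "A = x\<^sup>2 / a\<^sup>2 + z\<^sup>2 / b\<^sup>2" and B: "B = x * z / a\<^sup>2 - x * z / b\<^sup>2"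
    and C: "C = z\<^sup>2 / a\<^sup>2 + x\<^sup>2 / b\<^sup>2"
  shows "ellipse_axes E c (x, z) (s *\<^sub>R (- z, x)) a b \<longleftrightarrow> conic_form E c A B C"
proof -
  have a: "0 < a" using ab by simp
  have q: "((p \<bullet> (x, z)) / a)\<^sup>2 + ((p \<bullet> (s *\<^sub>R (- z, x))) / b)\<^sup>2 = quad A B C p" for p
  proof -
    have "((p \<bullet> (s *\<^sub>R (- z, x))) / b)\<^sup>2 = s\<^sup>2 * (p \<bullet> (- z, x))\<^sup>2 / b\<^sup>2"
      by (simp only: inner_scaleR_right power_divide power_mult_distrib)
    also have "\<dots> = (snd p * x - fst p * z)\<^sup>2 / b\<^sup>2"
      using s by (cases p) (simp add: algebra_simps)
    finally have v: "((p \<bullet> (s *\<^sub>R (- z, x))) / b)\<^sup>2 = (snd p * x - fst p * z)\<^sup>2 / b\<^sup>2" .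
    show ?thesis
      unfolding v A B C quad_def
      by (simp add: inner_prod_def power_divide)
         (simp add: power2_eq_square algebra_simps add_divide_distrib diff_divide_distrib)
  qed
  have "A * C - B\<^sup>2 = (x\<^sup>2 + z\<^sup>2)\<^sup>2 / (a\<^sup>2 * b\<^sup>2)"
    unfolding A B C using a ab
    by (simp add: field_simps) algebra
  then have D: "0 < A * C - B\<^sup>2" using a ab n by simp
  have "0 < A"
  proof (cases "x = 0")
    case True then show ?thesis using n a ab unfolding A by simp
  next
    case False then show ?thesis using a ab unfolding A by (simp add: add_pos_nonneg)
  qed
  moreover have "0 < A * C" using D zero_le_power2[of B] by linarith
  ultimately have "0 < A" "0 < C" by (auto simp: zero_less_mult_iff)
  moreover have "norm (x, z) = 1" using n by (simp add: norm_prod_def)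
  moreover have "norm (s *\<^sub>R (- z, x)) = 1"
    unfolding norm_scaleR using n s by (simp add: norm_prod_def add.commute abs_square_eq_1)
  moreover have "(x, z) \<bullet> (s *\<^sub>R (- z, x)) = 0" by simp
  ultimately show ?thesis using D ab
    unfolding ellipse_axes_def conic_form_def q by simp
qed

text \<open>
  The facts about axes that depend on the form alone: trace and determinant of its matrix \<open>M\<close> fix
  the lengths, and \<open>u\<close> and \<open>v\<close> are eigenvectors. The last expression is the planar cross product
  of \<open>d\<close> and \<open>M d\<close>; its vanishing means that \<open>d\<close> is an eigenvector.
\<close>

lemma ellipse_axes_conic_form:
  assumes ax: "ellipse_axes E c u v a b"
  obtains A B C where "conic_form E c A B C" "A + C = 1 / a\<^sup>2 + 1 / b\<^sup>2"
    "A * C - B\<^sup>2 = 1 / (a\<^sup>2 * b\<^sup>2)"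
    "\<And>d k. d = k *\<^sub>R u \<or> d = k *\<^sub>R v \<Longrightarrow>
       B * ((fst d)\<^sup>2 - (snd d)\<^sup>2) + (C - A) * fst d * snd d = 0"
proof -
  have ab: "0 < b" "b \<le> a" "0 < a" and uv: "norm u = 1" "norm v = 1" "u \<bullet> v = 0"
    using ax by (auto simp: ellipse_axes_def)
  obtain s where s: "s\<^sup>2 = 1" "v = s *\<^sub>R (- snd u, fst u)" "(fst u)\<^sup>2 + (snd u)\<^sup>2 = 1"
    using orthonormal_frame_cases[OF uv] .
  obtain x z where u: "u = (x, z)" by (cases u)
  have n: "x\<^sup>2 + z\<^sup>2 = 1" using s u by simp
  define A where "A = x\<^sup>2 / a\<^sup>2 + z\<^sup>2 / b\<^sup>2"
  define B where "B = x * z / a\<^sup>2 - x * z / b\<^sup>2"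
  define C where "C = z\<^sup>2 / a\<^sup>2 + x\<^sup>2 / b\<^sup>2"
  show ?thesis
  proof
    show "conic_form E c A B C"
      using ellipse_axes_iff_conic_form[OF s(1) n ab(1,2) A_def B_def C_def] ax s(2) u by simp
    have "A + C = (x\<^sup>2 + z\<^sup>2) / a\<^sup>2 + (x\<^sup>2 + z\<^sup>2) / b\<^sup>2"
      by (simp add: A_def C_def add_divide_distrib)
    then show "A + C = 1 / a\<^sup>2 + 1 / b\<^sup>2" using n by simp
    have "A * C - B\<^sup>2 = (x\<^sup>2 + z\<^sup>2)\<^sup>2 / (a\<^sup>2 * b\<^sup>2)"
      unfolding A_def B_def C_def using ab
      by (simp add: field_simps) algebra
    then show "A * C - B\<^sup>2 = 1 / (a\<^sup>2 * b\<^sup>2)" using n by simp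
    have e: "B * (x\<^sup>2 - z\<^sup>2) + (C - A) * x * z = 0"
      unfolding A_def B_def C_def using ab
      by (simp add: field_simps)
    fix d k assume "d = k *\<^sub>R u \<or> d = k *\<^sub>R v"
    then consider "fst d = k * x" "snd d = k * z"
      | "fst d = - (k * s * z)" "snd d = k * s * x"
      using s(2) u by auto
    then show "B * ((fst d)\<^sup>2 - (snd d)\<^sup>2) + (C - A) * fst d * snd d = 0"
    proof cases
      case 1
      have "B * ((fst d)\<^sup>2 - (snd d)\<^sup>2) + (C - A) * fst d * snd d =
            k\<^sup>2 * (B * (x\<^sup>2 - z\<^sup>2) + (C - A) * x * z)"
        unfolding 1 by (simp add: power2_eq_square algebra_simps)
      then show ?thesis using e by simp
    next
      case 2
      have "B * ((fst d)\<^sup>2 - (snd d)\<^sup>2) + (C - A) * fst d * snd d =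
            - ((k * s)\<^sup>2 * (B * (x\<^sup>2 - z\<^sup>2) + (C - A) * x * z))"
        unfolding 2 by (simp add: power2_eq_square algebra_simps)
      then show ?thesis using e by simp
    qed
  qed
qed

text \<open>
  Diagonalising a symmetric matrix of size two by a rotation. Writing
  \<open>(C - A, - 2 B)\<close> in polar coordinates \<open>(R, \<phi>)\<close>, the rotation by \<open>\<phi> / 2\<close> diagonalises, and
  the eigenvalues are \<open>(A + C - R) / 2\<close> and \<open>(A + C + R) / 2\<close>. Taking \<open>R \<ge> 0\<close> puts the smaller eigenvalue first,
  so that it belongs to the longer axis.
\<close>

lemma conic_form_is_ellipse:
  assumes "conic_form E c A B C"
  shows "is_ellipse E"
proof -
  define R where "R = sqrt ((C - A)\<^sup>2 + (2 * B)\<^sup>2)"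
  obtain \<phi> where \<phi>: "C - A = R * cos \<phi>" "- (2 * B) = R * sin \<phi>"
  proof (cases "R = 0")
    case True
    then have "C - A = 0 \<and> 2 * B = 0"
      unfolding R_def real_sqrt_eq_zero_cancel_iff sum_power2_eq_zero_iff .
    then show ?thesis using that[of 0] True by simp
  next
    case False
    then have R: "R > 0" using R_def by (metis less_eq_real_def real_sqrt_ge_zero sum_power2_ge_zero)
    have "R\<^sup>2 = (C - A)\<^sup>2 + (2 * B)\<^sup>2" unfolding R_def by simp
    then have "((C - A)\<^sup>2 + (2 * B)\<^sup>2) / R\<^sup>2 = 1" using R by (metis divide_self power_not_zero less_irrefl)
    then have "((C - A) / R)\<^sup>2 + (- (2 * B) / R)\<^sup>2 = 1"
      by (simp add: power_divide add_divide_distrib)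
    then obtain t where "(C - A) / R = cos t" "- (2 * B) / R = sin t"
      using sincos_total_2pi by blast
    then show ?thesis using that[of t] R by (simp add: field_simps)
  qed
  define x where "x = cos (\<phi> / 2)"
  define z where "z = sin (\<phi> / 2)"
  have n: "x\<^sup>2 + z\<^sup>2 = 1" by (simp add: x_def z_def)
  have cs: "cos \<phi> = x\<^sup>2 - z\<^sup>2" "sin \<phi> = 2 * x * z"
    using cos_double[of "\<phi> / 2"] sin_double[of "\<phi> / 2"] by (simp_all add: x_def z_def)
  have pos: "0 < A" "0 < C" "B\<^sup>2 < A * C" using assms by (auto simp: conic_form_def)
  have R0: "0 \<le> R" by (simp add: R_def)
  have "R\<^sup>2 = (C - A)\<^sup>2 + (2 * B)\<^sup>2" by (simp add: R_def)
  also have "\<dots> = (A + C)\<^sup>2 - 4 * (A * C - B\<^sup>2)" by (simp add: power2_eq_square algebra_simps)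
  also have "\<dots> < (A + C)\<^sup>2" using pos by simp
  \<comment> \<open>Positivity of the smaller eigenvalue is where \<open>B\<^sup>2 < A C\<close> enters.\<close>
  finally have RT: "R < A + C" using pos by (simp add: power2_less_imp_less)
  define l where "l = (A + C - R) / 2"
  define L where "L = (A + C + R) / 2"
  have l: "0 < l" "l \<le> L" "0 < L" using RT R0 by (simp_all add: l_def L_def)
  define a where "a = 1 / sqrt l"
  define b where "b = 1 / sqrt L"
  have ab: "0 < b" "b \<le> a" "a\<^sup>2 = 1 / l" "b\<^sup>2 = 1 / L"
    using l by (simp_all add: a_def b_def frac_le power_divide)
  have A: "A = x\<^sup>2 / a\<^sup>2 + z\<^sup>2 / b\<^sup>2"
  proof -
    have "2 * (x\<^sup>2 * l + z\<^sup>2 * L) = (A + C) * (x\<^sup>2 + z\<^sup>2) - R * (x\<^sup>2 - z\<^sup>2)"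
      by (simp add: l_def L_def field_simps)
    then show ?thesis using n \<phi> cs by (simp add: ab)
  qed
  have C: "C = z\<^sup>2 / a\<^sup>2 + x\<^sup>2 / b\<^sup>2"
  proof -
    have "2 * (z\<^sup>2 * l + x\<^sup>2 * L) = (A + C) * (x\<^sup>2 + z\<^sup>2) + R * (x\<^sup>2 - z\<^sup>2)"
      by (simp add: l_def L_def field_simps)
    then show ?thesis using n \<phi> cs by (simp add: ab)
  qed
  have B: "B = x * z / a\<^sup>2 - x * z / b\<^sup>2"
  proof -
    have "2 * (x * z * l - x * z * L) = - (R * (2 * x * z))"
      by (simp add: l_def L_def field_simps)
    then show ?thesis using \<phi> cs by (simp add: ab)
  qed
  have "ellipse_axes E c (x, z) (1 *\<^sub>R (- z, x)) a b"
    by (subst ellipse_axes_iff_conic_form[OF _ n ab(1,2) A B C]) (use assms in simp_all)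
  then show ?thesis unfolding is_ellipse_def by blast
qed

lemma principal_direction_eigenvector:
  assumes "conic_form E c A B C" "principal_direction E d"
  shows "B * ((fst d)\<^sup>2 - (snd d)\<^sup>2) + (C - A) * fst d * snd d = 0"
proof -
  obtain c' u v a b k where "ellipse_axes E c' u v a b" and d: "d = k *\<^sub>R u \<or> d = k *\<^sub>R v"
    using assms(2) unfolding principal_direction_def by blast
  then obtain A' B' C' where "conic_form E c' A' B' C'"
    "B' * ((fst d)\<^sup>2 - (snd d)\<^sup>2) + (C' - A') * fst d * snd d = 0"
    by (metis ellipse_axes_conic_form)
  then show ?thesis using conic_form_unique[OF assms(1)] by metis
qed

text \<open>
  If \<open>B = 0\<close>, the coordinate axes are the axes of the ellipse; which of them is the longer one
  depends on the order of \<open>A\<close> and \<open>C\<close>.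
\<close>

lemma vertical_principal_direction_iff:
  assumes E: "conic_form E c A B C"
  shows "principal_direction E (0, 1) \<longleftrightarrow> B = 0"
proof
  assume "principal_direction E (0, 1)"
  then show "B = 0" using principal_direction_eigenvector[OF E] by fastforce
next
  assume B: "B = 0"
  have pos: "0 < A" "0 < C" using E by (auto simp: conic_form_def)
  show "principal_direction E (0, 1)"
  proof (cases "A \<le> C")
    case True
    have "ellipse_axes E c (1, 0) (1 *\<^sub>R (- 0, 1)) (1 / sqrt A) (1 / sqrt C)"
      by (rule ellipse_axes_iff_conic_form[THEN iffD2, OF _ _ _ _ refl refl refl])
         (use E True pos B in \<open>simp_all add: power_divide frac_le\<close>)
    moreover have "(0, 1) = 1 *\<^sub>R (1 *\<^sub>R (- 0, 1 :: real))" by simp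
    moreover have "(0, 1 :: real) \<noteq> 0" by (simp add: zero_prod_def)
    ultimately show ?thesis unfolding principal_direction_def by blast
  next
    case False
    have "ellipse_axes E c (0, 1) (1 *\<^sub>R (- 1, 0)) (1 / sqrt C) (1 / sqrt A)"
      by (rule ellipse_axes_iff_conic_form[THEN iffD2, OF _ _ _ _ refl refl refl])
         (use E False pos B in \<open>simp_all add: power_divide frac_le\<close>)
    moreover have "(0, 1) = 1 *\<^sub>R (0, 1 :: real)" by simp
    moreover have "(0, 1 :: real) \<noteq> 0" by (simp add: zero_prod_def)
    ultimately show ?thesis unfolding principal_direction_def by blast
  qed
qed

section \<open>The axis ratio\<close>

lemma add_inverse_strict_antimono:
  fixes r r' :: real
  assumes "0 < r" "r \<le> 1" "0 < r'" "r' \<le> 1" "r + 1 / r < r' + 1 / r'"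
  shows "r' < r"
proof (rule ccontr)
  assume "\<not> r' < r"
  have "(r' + 1 / r') - (r + 1 / r) = (r' - r) * (r * r' - 1) / (r * r')"
    using assms by (simp add: field_simps)
  moreover have "r * r' \<le> 1" using assms by (simp add: mult_le_one)
  ultimately have "(r' + 1 / r') - (r + 1 / r) \<le> 0"
    using assms \<open>\<not> r' < r\<close> by (simp add: divide_nonpos_pos mult_nonneg_nonpos)
  then show False using assms by simp
qed

text \<open>
  Of the two roots \<open>r\<close> and \<open>1 / r\<close> of \<open>X\<^sup>2 - 2 w X + 1\<close>, the one in \<open>(0, 1]\<close> is the smaller.
\<close>

lemma lower_root:
  fixes r w :: real
  assumes "0 < r" "r \<le> 1" "r + 1 / r = 2 * w"
  shows "r = w - sqrt (w\<^sup>2 - 1)"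
proof -
  have "r * r \<le> 1" using assms by (simp add: mult_le_one)
  then have "r \<le> 1 / r" using assms by (simp add: field_simps)
  then have "0 \<le> w - r" using assms by simp
  moreover have "(w - r)\<^sup>2 = w\<^sup>2 - 1"
  proof -
    have "2 * w * r = r\<^sup>2 + 1" using assms by (simp add: field_simps power2_eq_square flip: assms(3))
    then show ?thesis by (simp add: power2_eq_square algebra_simps)
  qed
  ultimately have "sqrt (w\<^sup>2 - 1) = w - r" by (metis real_sqrt_unique)
  then show ?thesis by simp
qed

text \<open>
  Any choice of axes leads to the same value of \<open>r + 1 / r\<close>, so the ratio is well defined and the
  description in the definition of \<^const>\<open>axis_ratio\<close> denotes it.
\<close>

lemma axis_ratio_conic_form:
  assumes E: "conic_form E c A B C"
  shows "0 < axis_ratio E" "axis_ratio E \<le> 1"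
    "axis_ratio E + 1 / axis_ratio E = (A + C) / sqrt (A * C - B\<^sup>2)"
proof -
  let ?P = "\<lambda>r. \<exists>c u v a b. ellipse_axes E c u v a b \<and> r = (2 * b) / (2 * a)"
  have *: "0 < r \<and> r \<le> 1 \<and> r + 1 / r = (A + C) / sqrt (A * C - B\<^sup>2)" if P: "?P r" for r
  proof -
    obtain c' u v a b where ax: "ellipse_axes E c' u v a b" and "r = (2 * b) / (2 * a)"
      using P by blast
    then have r: "r = b / a" by simp
    have ab: "0 < b" "b \<le> a" "0 < a" using ax by (auto simp: ellipse_axes_def)
    have T: "A + C = 1 / a\<^sup>2 + 1 / b\<^sup>2" and D: "A * C - B\<^sup>2 = 1 / (a\<^sup>2 * b\<^sup>2)"
      using ellipse_axes_conic_form[OF ax] conic_form_unique[OF E] by metis+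
    have root: "sqrt (A * C - B\<^sup>2) = 1 / (a * b)"
      using ab by (simp add: D real_sqrt_divide real_sqrt_mult)
    have "(A + C) / sqrt (A * C - B\<^sup>2) = b / a + a / b"
      unfolding root T using ab by (simp add: field_simps power2_eq_square)
    then show ?thesis using ab r by simp
  qed
  have "\<exists>!r. ?P r"
  proof (rule ex_ex1I)
    show "\<exists>r. ?P r" using conic_form_is_ellipse[OF E] unfolding is_ellipse_def by blast
    show "r = r'" if "?P r" "?P r'" for r r'
    proof -
      define h where "h = (A + C) / sqrt (A * C - B\<^sup>2)"
      have "r = h / 2 - sqrt ((h / 2)\<^sup>2 - 1)" "r' = h / 2 - sqrt ((h / 2)\<^sup>2 - 1)"
        using *[OF that(1)] *[OF that(2)] by (simp_all add: lower_root flip: h_def)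
      then show ?thesis by simp
    qed
  qed
  from theI'[OF this] have "?P (axis_ratio E)" unfolding axis_ratio_def .
  from *[OF this] show "0 < axis_ratio E" "axis_ratio E \<le> 1"
    "axis_ratio E + 1 / axis_ratio E = (A + C) / sqrt (A * C - B\<^sup>2)" by auto
qed

section \<open>Evolution under the affinity\<close>

lemma conic_form_evolved:
  assumes E: "conic_form E c A B C"
  shows "conic_form (evolved E t) (affinity t c) A (B * exp t) (C * (exp t)\<^sup>2)"
proof -
  have inv: "affinity t p = q \<longleftrightarrow> p = affinity (- t) q" for p q
    by (cases p; cases q) (auto simp: affinity_def mult.assoc[symmetric] simp flip: exp_add)
  have "evolved E t = {q. affinity (- t) q \<in> E}"
    unfolding evolved_def image_def by (simp add: eq_commute[of _ "affinity t _"] inv)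
  also have "\<dots> = {q. quad A (B * exp t) (C * (exp t)\<^sup>2) (q - affinity t c) = 1}"
  proof -
    have "quad A B C (affinity (- t) q - c) = quad A (B * exp t) (C * (exp t)\<^sup>2) (q - affinity t c)"
      for q
    proof -
      have "exp t * exp (- t) = 1" by (simp add: exp_minus)
      then have "snd (affinity (- t) q - c) = exp t * snd (q - affinity t c)"
        by (cases c; cases q) (simp add: affinity_def right_diff_distrib mult.assoc[symmetric])
      moreover have "fst (affinity (- t) q - c) = fst (q - affinity t c)"
        by (cases c; cases q) (simp add: affinity_def)
      ultimately show ?thesis by (simp add: quad_def power2_eq_square)
    qed
    then show ?thesis using E by (simp add: conic_form_def)
  qed
  finally show ?thesis using E by (simp add: conic_form_def power_mult_distrib)
qed

text \<open>
  Both sides are a positive combination of \<open>e\<^sup>t\<close> and \<open>e\<^sup>-\<^sup>t\<close>; the shift by \<open>ln (A / C) / 2\<close> is the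
  one that makes the two coefficients equal, and the square root on the right is their common value.
\<close>

lemma trace_over_root_det_evolved:
  fixes A B C t :: real
  assumes "0 < A" "0 < C" "B\<^sup>2 < A * C"
  shows "(A + C * (exp t)\<^sup>2) / sqrt (A * (C * (exp t)\<^sup>2) - (B * exp t)\<^sup>2) =
    2 * (sqrt (A * C / (A * C - B\<^sup>2)) * cosh (t - ln (A / C) / 2))"
proof -
  define \<alpha> \<gamma> \<delta> where "\<alpha> = sqrt A" "\<gamma> = sqrt C" "\<delta> = sqrt (A * C - B\<^sup>2)"
  have pos: "0 < \<alpha>" "0 < \<gamma>" "0 < \<delta>" and sq: "A = \<alpha>\<^sup>2" "C = \<gamma>\<^sup>2"
    using assms by (simp_all add: \<alpha>_\<gamma>_\<delta>_def)
  have "A * (C * (exp t)\<^sup>2) - (B * exp t)\<^sup>2 = (A * C - B\<^sup>2) * (exp t)\<^sup>2"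
    by (simp add: power2_eq_square algebra_simps)
  then have d: "sqrt (A * (C * (exp t)\<^sup>2) - (B * exp t)\<^sup>2) = \<delta> * exp t"
    by (simp add: real_sqrt_mult \<alpha>_\<gamma>_\<delta>_def)
  have k: "sqrt (A * C / (A * C - B\<^sup>2)) = \<alpha> * \<gamma> / \<delta>"
    by (simp add: real_sqrt_mult real_sqrt_divide \<alpha>_\<gamma>_\<delta>_def)
  have "ln (A / C) / 2 = ln (\<alpha> / \<gamma>)"
    using pos by (simp add: sq ln_div ln_realpow)
  then have "2 * cosh (t - ln (A / C) / 2) = exp t / (\<alpha> / \<gamma>) + (\<alpha> / \<gamma>) / exp t"
    using pos by (simp add: cosh_def exp_diff exp_minus mult.commute)
  then have "2 * (\<alpha> * \<gamma> / \<delta> * cosh (t - ln (A / C) / 2)) =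
      \<alpha> * \<gamma> / \<delta> * (exp t / (\<alpha> / \<gamma>) + (\<alpha> / \<gamma>) / exp t)"
    by (simp add: mult.left_commute)
  also have "\<dots> = (\<alpha>\<^sup>2 + \<gamma>\<^sup>2 * (exp t)\<^sup>2) / (\<delta> * exp t)"
    using pos by (simp add: field_simps power2_eq_square)
  finally show ?thesis unfolding d k by (simp add: sq)
qed

section \<open>Smoothness\<close>

text \<open>
  The algebra of functions generated by \<open>G\<close> over the constants. If it contains the derivatives
  of its generators, it is closed under differentiation by the sum and product rules, and all its
  members are smooth.
\<close>

inductive_set function_algebra :: "(real \<Rightarrow> real) set \<Rightarrow> (real \<Rightarrow> real) set" for G where
  const: "(\<lambda>_. k) \<in> function_algebra G"
| gen: "g \<in> G \<Longrightarrow> g \<in> function_algebra G"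
| add: "f \<in> function_algebra G \<Longrightarrow> g \<in> function_algebra G \<Longrightarrow> (\<lambda>x. f x + g x) \<in> function_algebra G"
| mult: "f \<in> function_algebra G \<Longrightarrow> g \<in> function_algebra G \<Longrightarrow> (\<lambda>x. f x * g x) \<in> function_algebra G"

lemma function_algebra_derivative:
  assumes G: "\<And>g. g \<in> G \<Longrightarrow> \<exists>g'\<in>function_algebra G. \<forall>u\<in>U. (g has_real_derivative g' u) (at u)"
    and "f \<in> function_algebra G"
  shows "\<exists>f'\<in>function_algebra G. \<forall>u\<in>U. (f has_real_derivative f' u) (at u)"
  using assms(2)
proof induction
  case (const k)
  then show ?case using function_algebra.const[of 0 G] by force
next
  case (gen g)
  then show ?case by (rule G)
next
  case (add f g)
  then obtain f' g' where *: "f' \<in> function_algebra G" "g' \<in> function_algebra G"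
    "\<forall>u\<in>U. (f has_real_derivative f' u) (at u)" "\<forall>u\<in>U. (g has_real_derivative g' u) (at u)"
    by blast
  have "(\<lambda>x. f' x + g' x) \<in> function_algebra G" using * by (blast intro: function_algebra.add)
  then show ?case using *(3,4) by (rule_tac bexI) (auto intro: DERIV_add)
next
  case (mult f g)
  then obtain f' g' where *: "f' \<in> function_algebra G" "g' \<in> function_algebra G"
    "\<forall>u\<in>U. (f has_real_derivative f' u) (at u)" "\<forall>u\<in>U. (g has_real_derivative g' u) (at u)"
    by blast
  have "(\<lambda>x. f' x * g x + g' x * f x) \<in> function_algebra G"
    by (intro function_algebra.add function_algebra.mult * mult.hyps)
  then show ?case using *(3,4) by (rule_tac bexI) (auto intro: DERIV_mult)
qed

text \<open>
  By induction, each iterated derivative of \<open>y\<close> agrees on the open set \<open>U\<close> with a member of the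
  algebra. Requiring \<open>y = f\<close> only on \<open>U\<close> allows functions given piecewise.
\<close>

lemma smooth_at_function_algebra:
  assumes G: "\<And>g. g \<in> G \<Longrightarrow> \<exists>g'\<in>function_algebra G. \<forall>u\<in>U. (g has_real_derivative g' u) (at u)"
    and f: "f \<in> function_algebra G" and U: "open U" "x \<in> U" and y: "\<And>u. u \<in> U \<Longrightarrow> y u = f u"
  shows "smooth_at y x"
proof -
  have ex: "\<exists>h\<in>function_algebra G. \<forall>u\<in>U. (deriv ^^ n) y u = h u" for n
  proof (induction n)
    case 0
    then show ?case using f y by auto
  next
    case (Suc n)
    then obtain h where h: "h \<in> function_algebra G" "\<forall>u\<in>U. (deriv ^^ n) y u = h u" by blast
    then obtain h' where h': "h' \<in> function_algebra G" "\<forall>u\<in>U. (h has_real_derivative h' u) (at u)"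
      using function_algebra_derivative[OF G] by blast
    have "(deriv ^^ Suc n) y u = h' u" if "u \<in> U" for u
    proof -
      have "((deriv ^^ n) y has_real_derivative h' u) (at u)"
        by (rule has_field_derivative_transform_within_open[OF h'(2)[rule_format, OF that] U(1) that])
           (use h in simp)
      then show ?thesis by (simp add: DERIV_imp_deriv)
    qed
    then show ?case using h' by blast
  qed
  have "(deriv ^^ n) y differentiable (at u)" if "u \<in> U" for n u
  proof -
    obtain h where h: "h \<in> function_algebra G" "\<forall>u\<in>U. (deriv ^^ n) y u = h u" using ex by blast
    then obtain h' where h': "\<forall>u\<in>U. (h has_real_derivative h' u) (at u)"
      using function_algebra_derivative[OF G] by blast
    have "((deriv ^^ n) y has_real_derivative h' u) (at u)"
      by (rule has_field_derivative_transform_within_open[OF h'[rule_format, OF that] U(1) that])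
         (use h in simp)
    then show ?thesis using real_differentiable_def by blast
  qed
  then show ?thesis unfolding smooth_at_def using U by blast
qed

text \<open>
  The generators are \<open>w\<close>, its derivative, \<open>q = sqrt (w\<^sup>2 - 1)\<close> and \<open>1 / q\<close>. Since \<open>k > 1\<close> keeps \<open>q\<close>
  positive, their derivatives exist everywhere and are polynomials in the generators again.
\<close>

lemma smooth_at_lower_root:
  fixes k t\<^sub>0 :: real
  assumes k: "1 < k"
  defines "w \<equiv> \<lambda>t. k * cosh (t - t\<^sub>0)"
  shows "smooth_at (\<lambda>t. w t - sqrt ((w t)\<^sup>2 - 1)) t"
proof -
  define q where "q t = sqrt ((w t)\<^sup>2 - 1)" for t
  define w' where "w' t = k * sinh (t - t\<^sub>0)" for t
  define G where "G = {w, w', q, \<lambda>t. 1 / q t}"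
  have gen: "w \<in> function_algebra G" "w' \<in> function_algebra G" "q \<in> function_algebra G"
    "(\<lambda>t. 1 / q t) \<in> function_algebra G"
    by (simp_all add: G_def function_algebra.gen)
  have w1: "1 < (w t)\<^sup>2" for t
  proof -
    have "1 < w t" unfolding w_def using k cosh_real_ge_1[of "t - t\<^sub>0"]
      by (metis less_le_trans mult_left_mono mult.right_neutral less_eq_real_def zero_less_one order.strict_trans)
    then show ?thesis by (simp add: power2_eq_square less_1_mult)
  qed
  then have q0: "0 < q t" for t by (simp add: q_def)
  have dw: "(w has_real_derivative w' t) (at t)" for t
    unfolding w_def w'_def by (auto intro!: derivative_eq_intros)
  have dw': "(w' has_real_derivative w t) (at t)" for t
    unfolding w_def w'_def by (auto intro!: derivative_eq_intros)
  have dq: "(q has_real_derivative w t * w' t * (1 / q t)) (at t)" for t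
    unfolding q_def using w1[of t]
    by (auto intro!: derivative_eq_intros dw simp: field_simps)
  have dr: "((\<lambda>t. 1 / q t) has_real_derivative
      (-1) * (w t * w' t * (1 / q t) * (1 / q t) * (1 / q t))) (at t)" for t
    using q0[of t] by (auto intro!: derivative_eq_intros dq simp: field_simps)
  have "\<exists>g'\<in>function_algebra G. \<forall>u\<in>UNIV. (g has_real_derivative g' u) (at u)" if "g \<in> G" for g
  proof -
    have "(\<lambda>t. w t * w' t * (1 / q t)) \<in> function_algebra G"
      "(\<lambda>t. (-1) * (w t * w' t * (1 / q t) * (1 / q t) * (1 / q t))) \<in> function_algebra G"
      by (intro function_algebra.mult function_algebra.const gen)+
    then show ?thesis using that gen dw dw' dq dr unfolding G_def by fast
  qed
  moreover have "(\<lambda>t. w t + (-1) * q t) \<in> function_algebra G"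
    by (intro function_algebra.add function_algebra.mult function_algebra.const gen)
  ultimately show ?thesis
    by (rule smooth_at_function_algebra[where U = UNIV]) (simp_all add: q_def)
qed

text \<open>
  At \<open>t\<^sub>0\<close> a derivative would vanish because of the maximum, but the slope from the right is \<open>- 1\<close>.
  On either side of \<open>t\<^sub>0\<close> the function is an exponential.
\<close>

lemma smooth_at_exp_neg_abs_iff:
  fixes t\<^sub>0 :: real
  shows "smooth_at (\<lambda>t. exp (- \<bar>t - t\<^sub>0\<bar>)) t \<longleftrightarrow> t \<noteq> t\<^sub>0"
proof
  assume "smooth_at (\<lambda>t. exp (- \<bar>t - t\<^sub>0\<bar>)) t"
  then have "(\<lambda>t. exp (- \<bar>t - t\<^sub>0\<bar>)) differentiable (at t)"
    unfolding smooth_at_def by (metis funpow_0)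
  then obtain D where D: "((\<lambda>t. exp (- \<bar>t - t\<^sub>0\<bar>)) has_real_derivative D) (at t)"
    using real_differentiable_def by blast
  show "t \<noteq> t\<^sub>0"
  proof
    assume t: "t = t\<^sub>0"
    have "D = 0" by (rule DERIV_local_max[OF D, of 1]) (simp_all add: t)
    have "((\<lambda>t. exp (- (t - t\<^sub>0))) has_real_derivative D) (at t within {t..})"
      by (rule has_field_derivative_transform_within[OF has_field_derivative_at_within[OF D] zero_less_one])
        (auto simp: t)
    then have "((\<lambda>t. exp (- (t - t\<^sub>0))) has_real_derivative D) (at_right t)"
      by (rule has_field_derivative_subset) auto
    moreover have "((\<lambda>t. exp (- (t - t\<^sub>0))) has_real_derivative - 1) (at_right t)"
      by (auto intro!: derivative_eq_intros simp: t)
    ultimately have "D = - 1"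
      unfolding has_field_derivative_iff
      using tendsto_unique[OF trivial_limit_at_right_real] by blast
    with \<open>D = 0\<close> show False by simp
  qed
next
  assume t: "t \<noteq> t\<^sub>0"
  define e where "e = sgn (t - t\<^sub>0)"
  define f where "f u = exp (- e * (u - t\<^sub>0))" for u
  let ?U = "{u. 0 < e * (u - t\<^sub>0)}"
  have e: "\<bar>e\<bar> = 1" using t by (simp add: e_def abs_sgn_eq)
  show "smooth_at (\<lambda>t. exp (- \<bar>t - t\<^sub>0\<bar>)) t"
  proof (rule smooth_at_function_algebra[where G = "{f}" and U = ?U and f = f])
    show "\<exists>g'\<in>function_algebra {f}. \<forall>u\<in>?U. (g has_real_derivative g' u) (at u)" if "g \<in> {f}" for g
    proof
      show "(\<lambda>u. (- e) * f u) \<in> function_algebra {f}"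
        by (intro function_algebra.mult function_algebra.const function_algebra.gen) simp
      show "\<forall>u\<in>?U. (g has_real_derivative (- e) * f u) (at u)"
        using that by (auto simp: f_def[abs_def] intro!: derivative_eq_intros)
    qed
    show "f \<in> function_algebra {f}" by (rule function_algebra.gen) simp
    show "open ?U" by (intro open_Collect_less continuous_intros)
    show "t \<in> ?U" using t by (simp add: e_def sgn_if)
    show "exp (- \<bar>u - t\<^sub>0\<bar>) = f u" if "u \<in> ?U" for u
    proof -
      have "\<bar>u - t\<^sub>0\<bar> = \<bar>e * (u - t\<^sub>0)\<bar>" using e by (simp add: abs_mult)
      then show ?thesis using that by (simp add: f_def)
    qed
  qed
qed

section \<open>Extrema\<close>

text \<open>
  Arbitrarily close to any point there are points farther from \<open>t\<^sub>0\<close>, with smaller values, and,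
  unless the point is \<open>t\<^sub>0\<close> itself, also points nearer to \<open>t\<^sub>0\<close>, with larger values.
\<close>

lemma radially_decreasing_extrema:
  fixes f :: "real \<Rightarrow> real"
  assumes dec: "\<And>s s'. \<bar>s - t\<^sub>0\<bar> < \<bar>s' - t\<^sub>0\<bar> \<Longrightarrow> f s' < f s"
  shows "f s \<le> f t\<^sub>0" "local_max_on UNIV f s \<longleftrightarrow> s = t\<^sub>0" "\<not> local_min_on UNIV f s"
proof -
  show max: "f s \<le> f t\<^sub>0" for s
    using dec[of t\<^sub>0 s] by (cases "s = t\<^sub>0") auto
  have near: "\<exists>s'. s' \<noteq> s \<and> dist s' s < d \<and> \<bar>s' - t\<^sub>0\<bar> < \<bar>s - t\<^sub>0\<bar>" if "0 < d" "s \<noteq> t\<^sub>0" for d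
  proof (cases "t\<^sub>0 < s")
    case True
    define m where "m = min (d / 2) ((s - t\<^sub>0) / 2)"
    have "0 < m" "m < d" "m < s - t\<^sub>0" using that True by (auto simp: m_def min_def)
    then show ?thesis by (intro exI[of _ "s - m"]) (auto simp: dist_real_def)
  next
    case False
    define m where "m = min (d / 2) ((t\<^sub>0 - s) / 2)"
    have "0 < m" "m < d" "m < t\<^sub>0 - s" using that False by (auto simp: m_def min_def)
    then show ?thesis by (intro exI[of _ "s + m"]) (auto simp: dist_real_def)
  qed
  have far: "\<exists>s'. s' \<noteq> s \<and> dist s' s < d \<and> \<bar>s - t\<^sub>0\<bar> < \<bar>s' - t\<^sub>0\<bar>" if "0 < d" for d
  proof (cases "t\<^sub>0 \<le> s")
    case True
    then show ?thesis using that by (intro exI[of _ "s + d / 2"]) (auto simp: dist_real_def)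
  next
    case False
    then show ?thesis using that by (intro exI[of _ "s - d / 2"]) (auto simp: dist_real_def)
  qed
  show "local_max_on UNIV f s \<longleftrightarrow> s = t\<^sub>0"
  proof
    assume "local_max_on UNIV f s"
    then obtain d where "0 < d" "\<And>s'. s' \<noteq> s \<Longrightarrow> dist s' s < d \<Longrightarrow> f s' \<le> f s"
      by (auto simp: local_max_on_def eventually_at)
    then show "s = t\<^sub>0" using near[of d] dec by (meson not_le)
  next
    assume "s = t\<^sub>0"
    then show "local_max_on UNIV f s" using max by (simp add: local_max_on_def)
  qed
  show "\<not> local_min_on UNIV f s"
  proof
    assume "local_min_on UNIV f s"
    then obtain d where "0 < d" "\<And>s'. s' \<noteq> s \<Longrightarrow> dist s' s < d \<Longrightarrow> f s \<le> f s'"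
      by (auto simp: local_min_on_def eventually_at)
    then show False using far[of d] dec by (meson not_le)
  qed
qed

section \<open>The evolution of the axis ratio\<close>

theorem theorem5:
  fixes E :: "(real \<times> real) set" and y :: "real \<Rightarrow> real"
  assumes "is_ellipse E"
    and "\<And>t. y t = axis_ratio (evolved E t)"
  shows "(\<forall>t. is_ellipse (evolved E t) \<and> 0 < y t \<and> y t \<le> 1) \<and>
    (\<not> principal_direction E (0, 1) \<longrightarrow>
       (\<forall>t. smooth_at y t) \<and> quasiconcave_on UNIV y \<and>
       (\<exists>t. (\<forall>s. y s \<le> y t) \<and>
            (\<forall>d. principal_direction (evolved E t) d \<longrightarrow> line_angle d (1, 0) = pi / 4))) \<and>
    (principal_direction E (0, 1) \<longrightarrow>
       (\<exists>t. (\<forall>s. y s \<le> y t) \<and> (\<forall>s. local_max_on UNIV y s \<longleftrightarrow> s = t) \<and>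
            \<not> smooth_at y t \<and> (\<forall>s. s \<noteq> t \<longrightarrow> smooth_at y s)))"
proof -
  obtain c A B C where E: "conic_form E c A B C"
    using assms(1) ellipse_axes_conic_form unfolding is_ellipse_def by metis
  then have pos: "0 < A" "0 < C" "B\<^sup>2 < A * C" by (auto simp: conic_form_def)
  note Et = conic_form_evolved[OF E]
  define k where "k = sqrt (A * C / (A * C - B\<^sup>2))"
  define t\<^sub>0 where "t\<^sub>0 = ln (A / C) / 2"
  have y01: "0 < y t" "y t \<le> 1" for t
    using axis_ratio_conic_form(1,2)[OF Et] assms(2) by auto
  have y: "y t + 1 / y t = 2 * (k * cosh (t - t\<^sub>0))" for t
    using axis_ratio_conic_form(3)[OF Et] trace_over_root_det_evolved[OF pos] assms(2)
    by (simp add: k_def t\<^sub>0_def)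
  then have y_root: "y t = k * cosh (t - t\<^sub>0) - sqrt ((k * cosh (t - t\<^sub>0))\<^sup>2 - 1)" for t
    using lower_root[OF y01] by blast
  have k0: "0 < k" using pos by (simp add: k_def)
  have "y s' < y s" if "\<bar>s - t\<^sub>0\<bar> < \<bar>s' - t\<^sub>0\<bar>" for s s'
  proof (rule add_inverse_strict_antimono[OF y01 y01])
    have "cosh \<bar>s - t\<^sub>0\<bar> < cosh \<bar>s' - t\<^sub>0\<bar>"
      using that by (intro cosh_real_strict_mono) auto
    then show "y s + 1 / y s < y s' + 1 / y s'" using k0 by (simp add: y)
  qed
  note extrema = radially_decreasing_extrema[of t\<^sub>0 y, OF this]
  have smooth: "\<forall>t. smooth_at y t" if "\<not> principal_direction E (0, 1)"
  proof
    fix t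
    have "B \<noteq> 0" using that vertical_principal_direction_iff[OF E] by simp
    then have "1 < k" using pos by (simp add: k_def)
    moreover have "y = (\<lambda>t. k * cosh (t - t\<^sub>0) - sqrt ((k * cosh (t - t\<^sub>0))\<^sup>2 - 1))"
      by (rule ext) (rule y_root)
    ultimately show "smooth_at y t" by (metis smooth_at_lower_root)
  qed
  have angle: "line_angle d (1, 0) = pi / 4"
    if "\<not> principal_direction E (0, 1)" "principal_direction (evolved E t\<^sub>0) d" for d
  proof -
    have "B \<noteq> 0" using that vertical_principal_direction_iff[OF E] by simp
    have "exp t\<^sub>0 ^ 2 = exp (ln (A / C))" by (simp add: t\<^sub>0_def flip: exp_double)
    then have "C * (exp t\<^sub>0)\<^sup>2 = A" using pos by simp
    then have "\<bar>fst d\<bar> = \<bar>snd d\<bar>"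
      using principal_direction_eigenvector[OF Et that(2)] \<open>B \<noteq> 0\<close> by (simp add: power2_eq_iff abs_eq_iff)
    moreover have "d \<noteq> 0" using that(2) by (simp add: principal_direction_def)
    ultimately have "(snd d)\<^sup>2 = (fst d)\<^sup>2" "fst d \<noteq> 0"
      by (auto simp: prod_eq_iff power2_eq_iff abs_eq_iff)
    then have "norm d = sqrt 2 * \<bar>fst d\<bar>"
      by (simp add: norm_prod_def real_sqrt_mult flip: mult_2)
    with \<open>fst d \<noteq> 0\<close> have "\<bar>d \<bullet> (1, 0)\<bar> / (norm d * norm (1::real, 0::real)) = sqrt 2 / 2"
      by (simp add: inner_prod_def norm_prod_def field_simps)
    then show ?thesis unfolding line_angle_def by (simp only: flip: cos_45) (simp add: arccos_cos)
  qed
  have kink: "smooth_at y t \<longleftrightarrow> t \<noteq> t\<^sub>0" if "principal_direction E (0, 1)" for t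
  proof -
    have "B = 0" using that vertical_principal_direction_iff[OF E] by simp
    then have "k = 1" using pos by (simp add: k_def)
    have "y t = exp (- \<bar>t - t\<^sub>0\<bar>)" for t
    proof -
      let ?s = "\<bar>t - t\<^sub>0\<bar>"
      have "exp (- ?s) + 1 / exp (- ?s) = 2 * cosh ?s"
        by (simp add: cosh_def exp_minus field_simps)
      then have "exp (- ?s) = cosh ?s - sqrt ((cosh ?s)\<^sup>2 - 1)"
        by (intro lower_root) auto
      then show ?thesis using y_root[of t] \<open>k = 1\<close> by simp
    qed
    then have "y = (\<lambda>t. exp (- \<bar>t - t\<^sub>0\<bar>))" by (rule ext)
    then show ?thesis using smooth_at_exp_neg_abs_iff by simp
  qed
  show ?thesis
  proof (intro conjI impI allI)
    show "is_ellipse (evolved E t)" for t by (rule conic_form_is_ellipse[OF Et])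
    show "0 < y t" "y t \<le> 1" for t by (rule y01)+
    assume *: "\<not> principal_direction E (0, 1)"
    show "smooth_at y t" for t using smooth[OF *] by simp
    show "quasiconcave_on UNIV y" using extrema by (simp add: quasiconcave_on_def)
    show "\<exists>t. (\<forall>s. y s \<le> y t) \<and>
        (\<forall>d. principal_direction (evolved E t) d \<longrightarrow> line_angle d (1, 0) = pi / 4)"
      using extrema(1) angle[OF *] by (intro exI[of _ t\<^sub>0]) simp
  next
    assume *: "principal_direction E (0, 1)"
    show "\<exists>t. (\<forall>s. y s \<le> y t) \<and> (\<forall>s. local_max_on UNIV y s \<longleftrightarrow> s = t) \<and>
        \<not> smooth_at y t \<and> (\<forall>s. s \<noteq> t \<longrightarrow> smooth_at y s)"
      using extrema(1,2) kink[OF *] by (intro exI[of _ t\<^sub>0]) simp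
  qed
qed

end
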